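(* Let $a,b,r>0$ and let $g(u)=\frac{\exp(-bu)}{(1+\exp(-au))^r}$, $u\ge0$. Let $\mathbf X\sim GML_n(\boldsymbol\mu,\mathbf\Sigma,g)$, and for fixed $1\le m<n$ partition $$\mathbf X=\begin{pmatrix}\mathbf X^{(1)}\\ \mathbf X^{(2)}\end{pmatrix},\quad \boldsymbol\mu=\begin{pmatrix}\boldsymbol\mu^{(1)}\\ \boldsymbol\mu^{(2)}\end{pmatrix},\quad \mathbf\Sigma=\begin{pmatrix}\mathbf\Sigma_{11}&\mathbf\Sigma_{12}\\ \mathbf\Sigma_{21}&\mathbf\Sigma_{22}\end{pmatrix},$$ where $\mathbf X^{(1)},\boldsymbol\mu^{(1)}\in\mathbb R^m$, $\mathbf X^{(2)},\boldsymbol\mu^{(2)}\in\mathbb R^{n-m}$, $\mathbf\Sigma_{11}$ is $m\times m$, $\mathbf\Sigma_{12}$ is $m\times(n-m)$, $\mathbf\Sigma_{21}$ is $(n-m)\times m$ and $\mathbf\Sigma_{22}$ is $(n-m)\times(n-m)$. Then (i) $\mathbf X^{(1)}\sim Ell_m(\boldsymbol\mu^{(1)},\mathbf\Sigma_{11},g_{(m)})$; (ii) $\mathbf X^{(2)}\sim Ell_{n-m}(\boldsymbol\mu^{(2)},\mathbf\Sigma_{22},g_{(n-m)})$, where $g_{(k)}$ is the function $$g_{(k)}(t)=e^{-bt}a^{-\frac{n-k}{2}}\Gamma\left(\frac{n-k}{2}\right)\Phi^*_{r}\left(-e^{-at},\frac{n-k}{2},\frac ba\right),\quad t\ge 0,$$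 and $\Phi^*_r$ is the generalized Hurwitz-Lerch Zeta function. In particular, if $m=n-2$ and $a=b$, then $$g_{(n-2)}(t)=\begin{cases}\dfrac{1}{a(r-1)}\left(1-\dfrac{1}{(1+e^{-at})^{r-1}}\right), & \text{if } r\ne1,\\[2mm] \dfrac1a\ln(1+e^{-at}), & \text{if } r=1.\end{cases}$$
   Context: $\boldsymbol\mu\in\mathbb R^n$ and $\mathbf\Sigma$ is a symmetric positive definite $n\times n$ matrix; a prime denotes transpose. $\mathbf Z\sim Ell_k(\boldsymbol\nu,\mathbf S,h)$ (elliptically symmetric distribution with location $\boldsymbol\nu\in\mathbb R^k$, symmetric positive definite scale matrix $\mathbf S$ and density generator $h\ge 0$) means that $\mathbf Z$ has density on $\mathbb R^k$ equal to $C|\mathbf S|^{-1/2}h\big((\mathbf z-\boldsymbol\nu)'\mathbf S^{-1}(\mathbf z-\boldsymbol\nu)\big)$, with $C>0$ the normalizing constant (so $h$ matters only up to a positive constant factor). For $a,b,r>0$ and $g(u)=\frac{\exp(-bu)}{(1+\exp(-au))^r}$, $\mathbf X\sim GML_n(\boldsymbol\mu,\mathbf\Sigma,g)$ (generalized elliptically symmetric logistic distribution) means $\mathbf X\sim Ell_n(\boldsymbol\mu,\mathbf\Sigma,g)$ for this $g$. The generalized Hurwitz-Lerch Zeta function is $$\Phi^*_{\mu}(z,s,\alpha)=\frac{1}{\Gamma(\mu)}\sum_{k=0}^{\infty}\frac{\Gamma(\mu+k)}{k!}\frac{z^k}{(k+\alpha)^s},$$ with the integral representation $$\Phi^*_{\mu}(z,s,\alpha)=\frac{1}{\Gamma(s)}\int_0^{\infty}\frac{t^{s-1}e^{-\alpha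 t}}{(1-ze^{-t})^{\mu}}\,dt,$$ where $\mathrm{Re}(\alpha)>0$, and $\mathrm{Re}(s)>0$ when $|z|\le 1$, $z\ne 1$ ($\mathrm{Re}(s)>1$ when $z=1$). When the series does not converge (as can happen at $z=-1$), $\Phi^*_\mu$ is understood through the integral representation. *)

theory Defs
  imports "HOL-Probability.Probability"
begin

definition sym_pos_def :: "real^'k^'k \<Rightarrow> bool" where
  "sym_pos_def S \<longleftrightarrow> transpose S = S \<and> (\<forall>x. x \<noteq> 0 \<longrightarrow> x \<bullet> (S *v x) > 0)"

text \<open>The random vector \<open>Z\<close> on the probability space \<open>M\<close> has distribution
  \<open>Ell\<^sub>k(\<nu>, S, h)\<close>, where \<open>k\<close> is the cardinality of the index type.  Since \<open>M\<close> is a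
  probability space, the density integrates to one, so that \<open>C\<close> is necessarily the
  normalizing constant.  Only the values of \<open>h\<close> on \<open>[0, \<infinity>)\<close> matter.\<close>

definition Ell ::
  "'p measure \<Rightarrow> ('p \<Rightarrow> real^'k) \<Rightarrow> real^'k \<Rightarrow> real^'k^'k \<Rightarrow> (real \<Rightarrow> real) \<Rightarrow> bool" where
  "Ell M Z \<nu> S h \<longleftrightarrow>
     prob_space M \<and> sym_pos_def S \<and> (\<forall>u\<ge>0. h u \<ge> 0) \<and>
     (\<exists>C>0. distributed M lborel Z
        (\<lambda>z. ennreal (C * det S powr (-1/2) * h ((z - \<nu>) \<bullet> (matrix_inv S *v (z - \<nu>))))))"

definition gml_generator :: "real \<Rightarrow> real \<Rightarrow> real \<Rightarrow> real \<Rightarrow> real" where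
  "gml_generator a b r u = exp (- b * u) / (1 + exp (- a * u)) powr r"

definition GML ::
  "'p measure \<Rightarrow> ('p \<Rightarrow> real^'k) \<Rightarrow> real^'k \<Rightarrow> real^'k^'k \<Rightarrow> real \<Rightarrow> real \<Rightarrow> real \<Rightarrow> bool" where
  "GML M X \<mu> \<Sigma> a b r \<longleftrightarrow> Ell M X \<mu> \<Sigma> (gml_generator a b r)"

text \<open>The generalized Hurwitz-Lerch Zeta function \<open>\<Phi>\<^sup>*\<^sub>\<mu>(z, s, \<alpha>)\<close>, for real or complex
  arguments (with principal branches).  It is the sum of the series where that converges,
  possibly only conditionally; elsewhere it is given by the integral representation.  The
  definition is meaningful for parameters in the range of the integral representation.\<close>

definition hurwitz_lerch_term ::
  "'a \<Rightarrow> 'a \<Rightarrow> 'a \<Rightarrow> 'a \<Rightarrow> nat \<Rightarrow> 'a :: {Gamma, ln, second_countable_topology}" where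
  "hurwitz_lerch_term \<mu> z s \<alpha> k =
     Gamma (\<mu> + of_nat k) / fact k * (z ^ k / (of_nat k + \<alpha>) powr s)"

definition hurwitz_lerch_integral ::
  "'a \<Rightarrow> 'a \<Rightarrow> 'a \<Rightarrow> 'a \<Rightarrow> 'a :: {Gamma, ln, second_countable_topology}" where
  "hurwitz_lerch_integral \<mu> z s \<alpha> =
     1 / Gamma s * (LINT t:{0<..}|lborel.
       of_real t powr (s - 1) * exp (- \<alpha> * of_real t) / (1 - z * of_real (exp (- t))) powr \<mu>)"

definition hurwitz_lerch ::
  "'a \<Rightarrow> 'a \<Rightarrow> 'a \<Rightarrow> 'a \<Rightarrow> 'a :: {Gamma, ln, second_countable_topology}" where
  "hurwitz_lerch \<mu> z s \<alpha> =
     (if summable (hurwitz_lerch_term \<mu> z s \<alpha>)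
      then 1 / Gamma \<mu> * (\<Sum>k. hurwitz_lerch_term \<mu> z s \<alpha> k)
      else hurwitz_lerch_integral \<mu> z s \<alpha>)"

text \<open>The function \<open>g\<^sub>(\<^sub>k\<^sub>)\<close>, with the ambient dimension \<open>n\<close> made explicit.\<close>

definition gml_marginal_generator ::
  "real \<Rightarrow> real \<Rightarrow> real \<Rightarrow> nat \<Rightarrow> nat \<Rightarrow> real \<Rightarrow> real" where
  "gml_marginal_generator a b r n k t =
     exp (- b * t) * a powr (- ((real n - real k) / 2)) * Gamma ((real n - real k) / 2) *
     hurwitz_lerch r (- exp (- a * t)) ((real n - real k) / 2) (b / a)"

text \<open>Partitioned vectors and matrices.  The coordinates of the ambient space are indexed by
  a sum type, \<open>Inl\<close> indexing the first block and \<open>Inr\<close> the second one, so that the ambient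
  dimension is the sum of the two (positive) block dimensions.\<close>

definition block_vector :: "real^'m \<Rightarrow> real^'l \<Rightarrow> real^('m + 'l)" where
  "block_vector x y = (\<chi> i. case i of Inl p \<Rightarrow> x $ p | Inr q \<Rightarrow> y $ q)"

definition block_matrix ::
  "real^'m^'m \<Rightarrow> real^'l^'m \<Rightarrow> real^'m^'l \<Rightarrow> real^'l^'l \<Rightarrow> real^('m + 'l)^('m + 'l)" where
  "block_matrix A B C D =
     (\<chi> i. case i of Inl p \<Rightarrow> block_vector (A $ p) (B $ p)
                   | Inr q \<Rightarrow> block_vector (C $ q) (D $ q))"

end

theory Submission
  imports Defs
begin

text \<open>Completing the square gives
  \<open>(x - \<mu>)' \<Sigma>\<^sup>-\<^sup>1 (x - \<mu>) = (x\<^sub>1 - \<mu>\<^sub>1)' \<Sigma>\<^sub>1\<^sub>1\<^sup>-\<^sup>1 (x\<^sub>1 - \<mu>\<^sub>1) + R(x\<^sub>2 - y(x\<^sub>1))\<close>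
  with a positive definite quadratic form \<open>R\<close> in \<open>d = n - k\<close> variables.  Integrating out \<open>x\<^sub>2\<close>
  therefore turns the generator \<open>g\<close> into a constant multiple of
  \<open>t \<mapsto> \<integral>\<^sub>0\<^sup>\<infinity> u\<^sup>d\<^sup>/\<^sup>2\<^sup>-\<^sup>1 g(t + u) du\<close>, and the substitution \<open>v = a u\<close> identifies this integral with
  the integral representation of the Hurwitz-Lerch function.  Constants never have to be computed,
  because a density generator matters only up to a positive factor.\<close>

subsection \<open>The generalized Hurwitz-Lerch zeta function\<close>

text \<open>Abel's limit theorem. Multiplying by the geometric series shows that the power series is
  \<open>1 - x\<close> times the generating function of the partial sums. The weights
  \<open>(1 - x) * x ^ n\<close> have total mass 1 and shift towards large \<open>n\<close> as
  \<open>x\<close> tends to 1, so the limit of the partial sums wins.\<close>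

lemma Abel_limit_at_left:
  fixes c :: "nat \<Rightarrow> real"
  assumes "summable c"
  shows "((\<lambda>x. \<Sum>n. c n * x ^ n) \<longlongrightarrow> suminf c) (at_left 1)"
proof (rule tendstoI)
  fix e :: real assume "e > 0"
  define S where "S = suminf c"
  define d where "d n = (\<Sum>i\<le>n. c i) - S" for n
  have "d \<longlonglongrightarrow> S - S"
    unfolding d_def S_def using summable_LIMSEQ'[OF assms] by (intro tendsto_intros)
  then obtain N where N: "\<bar>d n\<bar> < e / 2" if "n \<ge> N" for n
    using \<open>e > 0\<close> LIMSEQ_D[of d 0 "e / 2"] by auto
  define K where "K = (\<Sum>n<N. \<bar>d n\<bar>)"
  have "K \<ge> 0" by (simp add: K_def sum_nonneg)
  \<comment> \<open>The lower bound on \<open>x\<close> is chosen to make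
    \<open>K * (1 - x) < e / 2\<close>; using \<open>K + 1\<close> keeps the quotient defined when
    \<open>K = 0\<close>.\<close>
  have close: "dist (\<Sum>n. c n * x ^ n) (suminf c) < e"
    if x: "max 0 (1 - e / (2 * (K + 1))) < x" "x < 1" for x
  proof -
    have x01: "0 < x" "x < 1" using x by auto
    have geo: "summable (\<lambda>n. norm (x ^ n))" using x01 by simp
    have cx: "summable (\<lambda>n. norm (c n * x ^ n))"
      using x01 powser_insidea[of c 1 x] assms by simp
    have "(\<Sum>i\<le>n. c i * x ^ i * x ^ (n - i)) = (d n + S) * x ^ n" for n
    proof -
      have "(\<Sum>i\<le>n. c i * x ^ i * x ^ (n - i)) = (\<Sum>i\<le>n. c i * x ^ n)"
        by (intro sum.cong) (auto simp: mult.assoc simp flip: power_add)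
      then show ?thesis by (simp add: d_def sum_distrib_right)
    qed
    then have "(\<lambda>n. (d n + S) * x ^ n) sums ((\<Sum>n. c n * x ^ n) * (1 / (1 - x)))"
      using Cauchy_product_sums[OF cx geo] x01 by (simp add: suminf_geometric)
    moreover have "(\<lambda>n. S * x ^ n) sums (S * (1 / (1 - x)))"
      using geometric_sums[of x] x01 by (intro sums_mult) auto
    ultimately have "(\<lambda>n. (d n + S) * x ^ n - S * x ^ n) sums
        ((\<Sum>n. c n * x ^ n) * (1 / (1 - x)) - S * (1 / (1 - x)))"
      by (rule sums_diff)
    then have dsums: "(\<lambda>n. d n * x ^ n) sums (((\<Sum>n. c n * x ^ n) - S) / (1 - x))"
      by (simp add: algebra_simps diff_divide_distrib)
    \<comment> \<open>The first \<open>N\<close> errors are bounded individually and contribute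
      \<open>K\<close>; the later ones are below \<open>e / 2\<close> and are controlled by the
      geometric series. Multiplication by \<open>1 - x\<close> then makes both contributions
      small.\<close>
    define B where "B n = (if n \<in> {..<N} then \<bar>d n\<bar> else 0) + e / 2 * x ^ n" for n
    have Bsums: "B sums (K + e / 2 * (1 / (1 - x)))"
      unfolding B_def K_def using geometric_sums[of x] x01
      by (intro sums_add sums_If_finite_set sums_mult) auto
    have dB: "norm (d n * x ^ n) \<le> B n" for n
    proof (cases "n < N")
      case True
      have "\<bar>d n\<bar> * x ^ n \<le> \<bar>d n\<bar> * 1"
        using x01 by (intro mult_left_mono power_le_one) auto
      moreover have "0 \<le> e / 2 * x ^ n" using x01 \<open>e > 0\<close> by simp
      moreover have "norm (d n * x ^ n) = \<bar>d n\<bar> * x ^ n" using x01 by (simp add: abs_mult)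
      moreover have "B n = \<bar>d n\<bar> + e / 2 * x ^ n" using True by (simp add: B_def)
      ultimately show ?thesis by linarith
    next
      case False
      have "\<bar>d n\<bar> * x ^ n \<le> e / 2 * x ^ n"
        using N[of n] False x01 by (intro mult_right_mono) auto
      moreover have "norm (d n * x ^ n) = \<bar>d n\<bar> * x ^ n" using x01 by (simp add: abs_mult)
      moreover have "B n = e / 2 * x ^ n" using False by (simp add: B_def)
      ultimately show ?thesis by linarith
    qed
    have "norm (((\<Sum>n. c n * x ^ n) - S) / (1 - x)) \<le> K + e / 2 * (1 / (1 - x))"
      using norm_suminf_le[of "\<lambda>n. d n * x ^ n" B] dB dsums Bsums by (simp add: sums_iff)
    also have "K + e / 2 * (1 / (1 - x)) = (K * (1 - x) + e / 2) / (1 - x)"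
      using x01 by (simp add: add_divide_distrib)
    finally have "\<bar>(\<Sum>n. c n * x ^ n) - S\<bar> \<le> K * (1 - x) + e / 2"
      using x01 by (simp add: divide_le_cancel)
    moreover have "K * (1 - x) < e / 2"
    proof -
      have "1 - x < e / (2 * (K + 1))" using x by simp
      then have "(K + 1) * (1 - x) < e / 2"
        using \<open>K \<ge> 0\<close> by (simp add: field_simps)
      moreover have "K * (1 - x) \<le> (K + 1) * (1 - x)" using x01 by (intro mult_right_mono) auto
      ultimately show ?thesis by linarith
    qed
    ultimately show ?thesis by (simp add: dist_real_def S_def)
  qed
  have "eventually (\<lambda>x. x \<in> {max 0 (1 - e / (2 * (K + 1)))<..<1}) (at_left (1::real))"
    using \<open>e > 0\<close> \<open>K \<ge> 0\<close> by (intro eventually_at_left_real) auto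
  then show "\<forall>\<^sub>F x in at_left 1. dist (\<Sum>n. c n * x ^ n) (suminf c) < e"
    by eventually_elim (use close in auto)
qed

text \<open>Euler's integral under the substitution \<open>t\<close> to \<open>c * t\<close>. It
  integrates each term of the zeta series, with \<open>c\<close> equal to
  \<open>k + \<alpha>\<close>, and supplies the dominating functions used later.\<close>

lemma has_bochner_integral_Gamma_scaled:
  fixes s c :: real
  assumes "s > 0" "c > 0"
  shows "has_bochner_integral lborel
    (\<lambda>t. indicator {0<..} t *\<^sub>R (t powr (s - 1) * exp (- c * t))) (Gamma s / c powr s)"
proof -
  define f where "f t = indicator {0<..} t *\<^sub>R (t powr (s - 1) * exp (- t))" for t :: real
  have "has_bochner_integral lborel f (Gamma s)"
  proof (rule has_bochner_integral_nn_integral)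
    show "f \<in> borel_measurable lborel" unfolding f_def[abs_def] by measurable
    have "ennreal (f t) = ennreal (indicator {0..} t * t powr (s - 1) / exp t)" for t
      by (auto simp: f_def indicator_def exp_minus field_simps)
    then show "(\<integral>\<^sup>+t. ennreal (f t) \<partial>lborel) = ennreal (Gamma s)"
      using Gamma_conv_nn_integral_real[OF assms(1)] by simp
  qed (use assms in \<open>auto simp: f_def Gamma_real_nonneg\<close>)
  then have "has_bochner_integral lborel (\<lambda>t. f (0 + c * t)) (Gamma s /\<^sub>R \<bar>c\<bar>)"
    using assms by (subst (asm) lborel_has_bochner_integral_real_affine_iff[where c = c and t = 0]) auto
  \<comment> \<open>The factor \<open>c powr (1 - s)\<close> cancels the power of \<open>c\<close>
    that the substitution leaves in the integrand.\<close>
  then have "has_bochner_integral lborel (\<lambda>t. c powr (1 - s) * f (0 + c * t))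
      (c powr (1 - s) * (Gamma s /\<^sub>R \<bar>c\<bar>))"
    by (rule has_bochner_integral_mult_right)
  moreover have "c powr (1 - s) * f (0 + c * t) =
      indicator {0<..} t *\<^sub>R (t powr (s - 1) * exp (- c * t))" for t
  proof (cases "t > 0")
    case True
    have "c powr (1 - s) * (c * t) powr (s - 1) = t powr (s - 1)"
      using assms True by (simp add: powr_mult flip: powr_add mult.assoc)
    then show ?thesis using True assms by (simp add: f_def)
  qed (use assms in \<open>auto simp: f_def indicator_def zero_less_mult_iff\<close>)
  moreover have "c powr (1 - s) * (Gamma s /\<^sub>R \<bar>c\<bar>) = Gamma s / c powr s"
    using assms by (simp add: powr_diff field_simps)
  ultimately show ?thesis by simp
qed

lemma negative_binomial_series:
  fixes \<mu> x :: real
  assumes "\<bar>x\<bar> < 1"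
  shows "(\<lambda>k. pochhammer \<mu> k / fact k * x ^ k) sums (1 / (1 - x) powr \<mu>)"
proof -
  have "(\<lambda>k. (- \<mu> gchoose k) * (- x) ^ k) sums (1 + - x) powr - \<mu>"
    using assms by (intro gen_binomial_real) auto
  moreover have "(- \<mu> gchoose k) * (- x) ^ k = pochhammer \<mu> k / fact k * x ^ k" for k
    by (simp add: gbinomial_pochhammer flip: power_mult_distrib)
  ultimately show ?thesis by (simp add: powr_minus divide_simps)
qed

text \<open>Expand \<open>1 / (1 - z * exp (- t)) powr \<mu>\<close> by the binomial series and
  integrate term by term. For \<open>\<bar>z\<bar> < 1\<close> the convergent series with terms
  \<open>c k * \<bar>z\<bar> ^ k\<close> controls everything, so sum and integral may be
  exchanged.\<close>

lemma hurwitz_lerch_sums: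
  fixes \<mu> z s \<alpha> :: real
  assumes "\<mu> > 0" "s > 0" "\<alpha> > 0" "\<bar>z\<bar> < 1"
  shows "hurwitz_lerch_term \<mu> z s \<alpha> sums (Gamma \<mu> * hurwitz_lerch_integral \<mu> z s \<alpha>)"
proof -
  define c where "c k = pochhammer \<mu> k / fact k" for k
  have c0: "c k \<ge> 0" for k using assms by (simp add: c_def pochhammer_nonneg)
  define f where "f k t = c k * z ^ k *
      (indicator {0<..} t *\<^sub>R (t powr (s - 1) * exp (- (real k + \<alpha>) * t)))" for k t
  have f: "has_bochner_integral lborel (f k) (c k * z ^ k * (Gamma s / (real k + \<alpha>) powr s))" for k
    unfolding f_def using assms
    by (intro has_bochner_integral_mult_right has_bochner_integral_Gamma_scaled) auto
  have fabs: "has_bochner_integral lborel (\<lambda>t. norm (f k t))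
      (c k * \<bar>z\<bar> ^ k * (Gamma s / (real k + \<alpha>) powr s))" for k
  proof -
    have eq: "norm (f k t) = c k * \<bar>z\<bar> ^ k *
        (indicator {0<..} t *\<^sub>R (t powr (s - 1) * exp (- (real k + \<alpha>) * t)))" for t
      using c0[of k] by (simp add: f_def abs_mult power_abs)
    show ?thesis
      unfolding eq using assms
      by (intro has_bochner_integral_mult_right has_bochner_integral_Gamma_scaled) auto
  qed
  have csum: "summable (\<lambda>k. c k * \<bar>z\<bar> ^ k)"
    using negative_binomial_series[of "\<bar>z\<bar>" \<mu>] assms unfolding c_def sums_iff by auto
  have fsums: "(\<lambda>k. f k t) sums (indicator {0<..} t *\<^sub>R
      (t powr (s - 1) * exp (- \<alpha> * t) / (1 - z * exp (- t)) powr \<mu>))" for t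
  proof (cases "t > 0")
    case True
    have "\<bar>z * exp (- t)\<bar> \<le> \<bar>z\<bar> * 1"
      using True unfolding abs_mult by (intro mult_left_mono) auto
    then have "(\<lambda>k. c k * (z * exp (- t)) ^ k) sums (1 / (1 - z * exp (- t)) powr \<mu>)"
      using assms negative_binomial_series[of "z * exp (- t)" \<mu>] unfolding c_def by simp
    then have "(\<lambda>k. t powr (s - 1) * exp (- \<alpha> * t) * (c k * (z * exp (- t)) ^ k)) sums
        (t powr (s - 1) * exp (- \<alpha> * t) * (1 / (1 - z * exp (- t)) powr \<mu>))"
      by (rule sums_mult)
    moreover have "t powr (s - 1) * exp (- \<alpha> * t) * (c k * (z * exp (- t)) ^ k) = f k t" for k
    proof -
      have "exp (- \<alpha> * t) * exp (- t) ^ k = exp (- (real k + \<alpha>) * t)"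
        by (simp add: exp_of_nat_mult[symmetric] exp_add[symmetric] algebra_simps)
      then show ?thesis using True by (simp add: f_def power_mult_distrib mult_ac)
    qed
    ultimately show ?thesis using True by simp
  qed (simp add: f_def)
  have fnorm: "summable (\<lambda>k. norm (f k t))" for t
  proof (rule summable_comparison_test')
    show "summable (\<lambda>k. (c k * \<bar>z\<bar> ^ k) * t powr (s - 1))"
      using csum by (rule summable_mult2)
    show "norm (norm (f k t)) \<le> (c k * \<bar>z\<bar> ^ k) * t powr (s - 1)" for k
    proof (cases "t > 0")
      case True
      have "exp (- (real k + \<alpha>) * t) \<le> 1" using assms True by (simp add: mult_le_0_iff)
      then have "(c k * \<bar>z\<bar> ^ k) * (t powr (s - 1) * exp (- (real k + \<alpha>) * t)) \<le>
          (c k * \<bar>z\<bar> ^ k) * (t powr (s - 1) * 1)"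
        using c0[of k] by (intro mult_left_mono) auto
      then show ?thesis using True c0[of k] by (simp add: f_def abs_mult power_abs)
    qed (use c0[of k] in \<open>simp add: f_def\<close>)
  qed
  \<comment> \<open>Each integral is largest when \<open>k + \<alpha>\<close> is replaced by
    \<open>\<alpha>\<close>, which leaves a constant multiple of the dominating series.\<close>
  have fint: "summable (\<lambda>k. \<integral>t. norm (f k t) \<partial>lborel)"
  proof (rule summable_comparison_test')
    show "summable (\<lambda>k. (c k * \<bar>z\<bar> ^ k) * (Gamma s / \<alpha> powr s))"
      using csum by (rule summable_mult2)
    show "norm (\<integral>t. norm (f k t) \<partial>lborel) \<le> (c k * \<bar>z\<bar> ^ k) * (Gamma s / \<alpha> powr s)" for k
    proof -
      have "(\<integral>t. norm (f k t) \<partial>lborel) = c k * \<bar>z\<bar> ^ k * (Gamma s / (real k + \<alpha>) powr s)"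
        by (rule has_bochner_integral_integral_eq[OF fabs])
      also have "\<dots> \<le> (c k * \<bar>z\<bar> ^ k) * (Gamma s / \<alpha> powr s)"
        using assms c0[of k] Gamma_real_pos[of s]
        by (intro mult_left_mono divide_left_mono powr_mono2) auto
      finally show ?thesis by simp
    qed
  qed
  have "(\<lambda>k. \<integral>t. f k t \<partial>lborel) sums (\<integral>t. (\<Sum>k. f k t) \<partial>lborel)"
    using f fnorm fint by (intro sums_integral) (auto simp: has_bochner_integral_iff)
  moreover have "(\<integral>t. (\<Sum>k. f k t) \<partial>lborel) = Gamma s * hurwitz_lerch_integral \<mu> z s \<alpha>"
    using fsums Gamma_real_pos[OF assms(2)]
    by (simp add: sums_iff hurwitz_lerch_integral_def set_lebesgue_integral_def)
  moreover have "(\<integral>t. f k t \<partial>lborel) = c k * z ^ k * (Gamma s / (real k + \<alpha>) powr s)" for k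
    by (rule has_bochner_integral_integral_eq[OF f])
  ultimately have "(\<lambda>k. c k * z ^ k * (Gamma s / (real k + \<alpha>) powr s)) sums
      (Gamma s * hurwitz_lerch_integral \<mu> z s \<alpha>)" by simp
  then have "(\<lambda>k. Gamma \<mu> / Gamma s * (c k * z ^ k * (Gamma s / (real k + \<alpha>) powr s))) sums
      (Gamma \<mu> / Gamma s * (Gamma s * hurwitz_lerch_integral \<mu> z s \<alpha>))"
    by (rule sums_mult)
  moreover have "Gamma \<mu> / Gamma s * (c k * z ^ k * (Gamma s / (real k + \<alpha>) powr s)) =
      hurwitz_lerch_term \<mu> z s \<alpha> k" for k
  proof -
    \<comment> \<open>Away from the poles of Gamma, \<open>pochhammer \<mu> k\<close> is the
      quotient \<open>Gamma (\<mu> + k) / Gamma \<mu>\<close>.\<close>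
    have "\<mu> \<notin> \<int>\<^sub>\<le>\<^sub>0" using assms by (auto elim!: nonpos_Ints_cases)
    then show ?thesis
      using Gamma_real_pos[OF assms(1)] Gamma_real_pos[OF assms(2)]
      by (simp add: c_def pochhammer_Gamma hurwitz_lerch_term_def field_simps)
  qed
  ultimately show ?thesis using Gamma_real_pos[OF assms(2)] by simp
qed

text \<open>At \<open>z = -1\<close> the series may converge only conditionally, hence the appeal to Abel's theorem.\<close>

lemma hurwitz_lerch_eq_integral:
  fixes \<mu> z s \<alpha> :: real
  assumes "\<mu> > 0" "s > 0" "\<alpha> > 0" "-1 \<le> z" "z < 1"
  shows "hurwitz_lerch \<mu> z s \<alpha> = hurwitz_lerch_integral \<mu> z s \<alpha>"
proof (cases "z = -1")
  case False
  then have "hurwitz_lerch_term \<mu> z s \<alpha> sums (Gamma \<mu> * hurwitz_lerch_integral \<mu> z s \<alpha>)"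
    using assms by (intro hurwitz_lerch_sums) auto
  then show ?thesis
    using Gamma_real_pos[OF assms(1)] by (simp add: hurwitz_lerch_def sums_iff)
next
  case True
  show ?thesis
  \<comment> \<open>If the series diverges, the definition already falls back on the integral. If it
    converges, the integrals at \<open>- x n\<close> with \<open>x n\<close> increasing to 1 are
    shown to have two limits, one by Abel's theorem and one by dominated convergence, which must
    agree.\<close>
  proof (cases "summable (hurwitz_lerch_term \<mu> z s \<alpha>)")
    case summ: True
    define x where "x n = 1 + - inverse (real (Suc n))" for n
    have x: "0 \<le> x n" "x n < 1" for n by (auto simp: x_def field_simps)
    have xlim: "x \<longlonglongrightarrow> 1" unfolding x_def by (rule LIMSEQ_inverse_real_of_nat_add_minus)
    then have xat: "filterlim x (at_left 1) sequentially"
      using x by (auto intro!: tendsto_imp_filterlim_at_left)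
    have "hurwitz_lerch_term \<mu> z s \<alpha> k * x n ^ k = hurwitz_lerch_term \<mu> (- x n) s \<alpha> k" for k n
      using True by (simp add: hurwitz_lerch_term_def power_minus[of "x n"])
    then have "(\<Sum>k. hurwitz_lerch_term \<mu> z s \<alpha> k * x n ^ k) =
        Gamma \<mu> * hurwitz_lerch_integral \<mu> (- x n) s \<alpha>" for n
      using hurwitz_lerch_sums[of \<mu> s \<alpha> "- x n"] assms x[of n] by (simp add: sums_iff)
    then have lim1: "(\<lambda>n. Gamma \<mu> * hurwitz_lerch_integral \<mu> (- x n) s \<alpha>) \<longlonglongrightarrow>
        suminf (hurwitz_lerch_term \<mu> z s \<alpha>)"
      using filterlim_compose[OF Abel_limit_at_left[OF summ] xat] by simp
    have "(\<lambda>n. \<integral>t. indicator {0<..} t *\<^sub>R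
          (t powr (s - 1) * exp (- \<alpha> * t) / (1 - (- x n) * exp (- t)) powr \<mu>) \<partial>lborel) \<longlonglongrightarrow>
        (\<integral>t. indicator {0<..} t *\<^sub>R
          (t powr (s - 1) * exp (- \<alpha> * t) / (1 - z * exp (- t)) powr \<mu>) \<partial>lborel)"
    proof (rule integral_dominated_convergence)
      show "integrable lborel (\<lambda>t. indicator {0<..} t *\<^sub>R (t powr (s - 1) * exp (- \<alpha> * t)))"
        using has_bochner_integral_Gamma_scaled[OF assms(2,3)] by (simp add: has_bochner_integral_iff)
      have base: "(\<lambda>n. 1 - (- x n) * exp (- t)) \<longlonglongrightarrow> 1 - z * exp (- t)" for t
        using True by (auto intro!: tendsto_eq_intros xlim)
      have pos: "1 - z * exp (- t) > 0" for t
        using True by (simp add: add_pos_pos)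
      show "AE t in lborel. (\<lambda>n. indicator {0<..} t *\<^sub>R
          (t powr (s - 1) * exp (- \<alpha> * t) / (1 - (- x n) * exp (- t)) powr \<mu>)) \<longlonglongrightarrow>
        indicator {0<..} t *\<^sub>R
          (t powr (s - 1) * exp (- \<alpha> * t) / (1 - z * exp (- t)) powr \<mu>)"
        using less_imp_neq[OF pos, symmetric]
        by (intro AE_I2 tendsto_scaleR tendsto_divide tendsto_powr tendsto_const base) simp_all
      show "AE t in lborel. norm (indicator {0<..} t *\<^sub>R
          (t powr (s - 1) * exp (- \<alpha> * t) / (1 - (- x n) * exp (- t)) powr \<mu>)) \<le>
          indicator {0<..} t *\<^sub>R (t powr (s - 1) * exp (- \<alpha> * t))" for n
      proof (rule AE_I2)
        fix t :: real
        \<comment> \<open>The argument \<open>- x n\<close> is nonpositive, so the denominator is at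
          least 1 and the Gamma integrand dominates uniformly in \<open>n\<close>.\<close>
        have "1 \<le> (1 - (- x n) * exp (- t)) powr \<mu>"
          using x[of n] assms by (intro ge_one_powr_ge_zero) auto
        then have "t powr (s - 1) * exp (- \<alpha> * t) / (1 - (- x n) * exp (- t)) powr \<mu> \<le>
            t powr (s - 1) * exp (- \<alpha> * t) / 1"
          by (intro divide_left_mono) auto
        then show "norm (indicator {0<..} t *\<^sub>R
          (t powr (s - 1) * exp (- \<alpha> * t) / (1 - (- x n) * exp (- t)) powr \<mu>)) \<le>
          indicator {0<..} t *\<^sub>R (t powr (s - 1) * exp (- \<alpha> * t))"
          by (auto simp: indicator_def abs_mult)
      qed
    qed auto
    then have "(\<lambda>n. Gamma \<mu> * (1 / Gamma s * (\<integral>t. indicator {0<..} t *\<^sub>R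
          (t powr (s - 1) * exp (- \<alpha> * t) / (1 - (- x n) * exp (- t)) powr \<mu>) \<partial>lborel))) \<longlonglongrightarrow>
        Gamma \<mu> * (1 / Gamma s * (\<integral>t. indicator {0<..} t *\<^sub>R
          (t powr (s - 1) * exp (- \<alpha> * t) / (1 - z * exp (- t)) powr \<mu>) \<partial>lborel))"
      by (intro tendsto_mult_left)
    then have lim2: "(\<lambda>n. Gamma \<mu> * hurwitz_lerch_integral \<mu> (- x n) s \<alpha>) \<longlonglongrightarrow>
        Gamma \<mu> * hurwitz_lerch_integral \<mu> z s \<alpha>"
      by (simp add: hurwitz_lerch_integral_def set_lebesgue_integral_def)
    show ?thesis
      using LIMSEQ_unique[OF lim1 lim2] summ Gamma_real_pos[OF assms(1)]
      by (simp add: hurwitz_lerch_def)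
  qed (simp add: hurwitz_lerch_def)
qed

subsection \<open>The marginal generator\<close>

text \<open>The substitution \<open>v = a * u\<close> in the integral representation produces the
  factors \<open>a powr s\<close> and \<open>exp (b * t)\<close>, which the prefactors in the
  definition of \<open>gml_marginal_generator\<close> cancel. Integrability follows by comparison
  with \<open>u powr (s - 1) * exp (- b * u)\<close>.\<close>

lemma gml_marginal_generator_integral:
  fixes a b r t :: real and n k :: nat
  assumes "a > 0" "b > 0" "r > 0" "k < n" "t \<ge> 0"
  defines "s \<equiv> (real n - real k) / 2"
  shows "has_bochner_integral lborel
    (\<lambda>u. indicator {0<..} u *\<^sub>R (u powr (s - 1) * gml_generator a b r (t + u)))
    (gml_marginal_generator a b r n k t)"
proof -
  define F where "F u = indicator {0<..} u *\<^sub>R (u powr (s - 1) * gml_generator a b r (t + u))" for u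
  define G where "G v = indicator {0<..} v *\<^sub>R (v powr (s - 1) * exp (- (b / a) * v) /
    (1 - (- exp (- a * t)) * exp (- v)) powr r)" for v
  have s: "s > 0" using assms by (simp add: s_def)
  have meas: "F \<in> borel_measurable lborel"
    unfolding F_def[abs_def] gml_generator_def by measurable
  have "integrable lborel F"
  proof (rule Bochner_Integration.integrable_bound[OF _ meas])
    show "integrable lborel (\<lambda>u. indicator {0<..} u *\<^sub>R (u powr (s - 1) * exp (- b * u)))"
      using has_bochner_integral_Gamma_scaled[OF s assms(2)] by (simp add: has_bochner_integral_iff)
    show "AE u in lborel. norm (F u) \<le> norm (indicator {0<..} u *\<^sub>R (u powr (s - 1) * exp (- b * u)))"
    proof (rule AE_I2)
      fix u :: real
      show "norm (F u) \<le> norm (indicator {0<..} u *\<^sub>R (u powr (s - 1) * exp (- b * u)))"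
      proof (cases "u > 0")
        case True
        have "1 \<le> (1 + exp (- a * (t + u))) powr r"
          using assms by (intro ge_one_powr_ge_zero) auto
        then have "gml_generator a b r (t + u) \<le> exp (- b * (t + u)) / 1"
          unfolding gml_generator_def by (intro divide_left_mono) auto
        also have "\<dots> \<le> exp (- b * u)" using assms by simp
        finally have "u powr (s - 1) * gml_generator a b r (t + u) \<le> u powr (s - 1) * exp (- b * u)"
          by (intro mult_left_mono) auto
        moreover have "gml_generator a b r (t + u) \<ge> 0" by (simp add: gml_generator_def)
        ultimately show ?thesis using True by (simp add: F_def abs_mult)
      qed (simp add: F_def)
    qed
  qed
  moreover have "integral\<^sup>L lborel F = gml_marginal_generator a b r n k t"
  proof -
    have GF: "G (0 + a * u) = a powr (s - 1) * exp (b * t) * F u" for u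
    proof (cases "u > 0")
      case True
      have "exp (- (b / a) * (a * u)) = exp (b * t) * exp (- b * (t + u))"
        using assms by (simp add: algebra_simps flip: exp_add)
      moreover have "exp (- a * t) * exp (- (a * u)) = exp (- a * (t + u))"
        by (simp add: algebra_simps flip: exp_add)
      ultimately show ?thesis using True assms
        by (simp add: G_def F_def gml_generator_def powr_mult)
    qed (use assms in \<open>auto simp: G_def F_def zero_less_mult_iff\<close>)
    have "integral\<^sup>L lborel G = \<bar>a\<bar> *\<^sub>R (\<integral>u. G (0 + a * u) \<partial>lborel)"
      using assms by (intro lborel_integral_real_affine) auto
    also have "\<dots> = a powr s * exp (b * t) * integral\<^sup>L lborel F"
      unfolding GF using assms by (simp add: powr_diff)
    finally have "hurwitz_lerch_integral r (- exp (- a * t)) s (b / a) =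
        1 / Gamma s * (a powr s * exp (b * t) * integral\<^sup>L lborel F)"
      by (simp add: hurwitz_lerch_integral_def set_lebesgue_integral_def G_def[abs_def])
    \<comment> \<open>The argument lies between -1 and 0 and equals -1 exactly at
      \<open>t = 0\<close>; this is where the boundary case of the zeta function enters.\<close>
    moreover have "hurwitz_lerch r (- exp (- a * t)) s (b / a) =
        hurwitz_lerch_integral r (- exp (- a * t)) s (b / a)"
    proof (rule hurwitz_lerch_eq_integral)
      show "- exp (- a * t) < 1" using exp_gt_zero[of "- a * t"] by linarith
    qed (use assms s in auto)
    ultimately have "gml_marginal_generator a b r n k t = exp (- b * t) * a powr (- s) * Gamma s *
        (1 / Gamma s * (a powr s * exp (b * t) * integral\<^sup>L lborel F))"
      by (simp only: gml_marginal_generator_def s_def[symmetric])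
    also have "\<dots> = (exp (- b * t) * exp (b * t)) * (a powr (- s) * a powr s) * integral\<^sup>L lborel F"
      using Gamma_real_pos[OF s] by simp
    also have "\<dots> = integral\<^sup>L lborel F"
      using assms(1) by (simp flip: exp_add powr_add)
    finally show ?thesis ..
  qed
  ultimately show ?thesis by (simp add: has_bochner_integral_iff F_def[abs_def])
qed

lemma gml_marginal_generator_nonneg:
  assumes "a > 0" "b > 0" "r > 0" "k < n" "t \<ge> 0"
  shows "gml_marginal_generator a b r n k t \<ge> 0"
  unfolding has_bochner_integral_integral_eq[OF gml_marginal_generator_integral[OF assms], symmetric]
  by (intro integral_nonneg_AE) (simp add: gml_generator_def)

text \<open>The same identity for nonnegative integrals, in the shape that
  \<open>Ell_marginal\<close> asks of its generator \<open>G\<close>.\<close>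

lemma gml_marginal_generator_nn_integral:
  fixes a b r t :: real and n k :: nat
  assumes "a > 0" "b > 0" "r > 0" "k < n" "t \<ge> 0"
  shows "(\<integral>\<^sup>+u. indicator {0<..} u * ennreal (u powr ((real n - real k) / 2 - 1)) *
      ennreal (gml_generator a b r (t + u)) \<partial>lborel) =
    ennreal (gml_marginal_generator a b r n k t)"
proof -
  note int = gml_marginal_generator_integral[OF assms, unfolded has_bochner_integral_iff]
  have "(\<integral>\<^sup>+u. indicator {0<..} u * ennreal (u powr ((real n - real k) / 2 - 1)) *
      ennreal (gml_generator a b r (t + u)) \<partial>lborel) = (\<integral>\<^sup>+u. ennreal (indicator {0<..} u *\<^sub>R
      (u powr ((real n - real k) / 2 - 1) * gml_generator a b r (t + u))) \<partial>lborel)"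
    by (intro nn_integral_cong) (auto simp: indicator_def ennreal_mult')
  also have "\<dots> = ennreal (gml_marginal_generator a b r n k t)"
    using nn_integral_eq_integral[OF conjunct1[OF int]] conjunct2[OF int]
    by (simp add: gml_generator_def)
  finally show ?thesis .
qed

text \<open>In codimension two the weight \<open>u powr (s - 1)\<close> is constant, and for equal
  \<open>a\<close> and \<open>b\<close> the numerator of the generator is, up to a constant, the
  derivative of the base \<open>1 + exp (- a * (t + u))\<close>. Hence there is an elementary
  antiderivative, logarithmic exactly when \<open>r = 1\<close>.\<close>

lemma gml_marginal_generator_codim_2:
  fixes a r t :: real and n :: nat
  assumes "a > 0" "r > 0" "n \<ge> 2" "t \<ge> 0"
  shows "gml_marginal_generator a a r n (n - 2) t =
    (if r \<noteq> 1 then 1 / (a * (r - 1)) * (1 - 1 / (1 + exp (- a * t)) powr (r - 1))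
     else 1 / a * ln (1 + exp (- a * t)))"
proof -
  \<comment> \<open>\<open>F\<close> is the antiderivative in \<open>u\<close>, and \<open>T\<close>
    below is its limit at infinity, where the base tends to 1.\<close>
  define F where "F u = (if r \<noteq> 1 then 1 / (a * (r - 1)) * (1 + exp (- a * (t + u))) powr (1 - r)
     else - (1 / a) * ln (1 + exp (- a * (t + u))))" for u
  define T where "T = (if r \<noteq> 1 then 1 / (a * (r - 1)) else 0)"
  have pos: "1 + exp x > 0" for x :: real by (simp add: add_pos_pos)
  have deriv: "DERIV F u :> gml_generator a a r (t + u)" for u
  proof (cases "r = 1")
    case True
    have "((\<lambda>u. - (1 / a) * ln (1 + exp (- a * (t + u)))) has_real_derivative
        - (1 / a) * (1 / (1 + exp (- a * (t + u))) * (exp (- a * (t + u)) * (- a)))) (at u)"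
      using pos[of "- a * (t + u)"] by (auto intro!: derivative_eq_intros)
    then show ?thesis
      using True assms pos[of "- a * (t + u)"] by (simp add: F_def[abs_def] gml_generator_def)
  next
    case False
    have "((\<lambda>u. 1 / (a * (r - 1)) * (1 + exp (- a * (t + u))) powr (1 - r)) has_real_derivative
        1 / (a * (r - 1)) * ((1 - r) * (1 + exp (- a * (t + u))) powr (1 - r - 1) *
          (exp (- a * (t + u)) * (- a)))) (at u)"
      using pos[of "- a * (t + u)"]
      by (intro DERIV_cmult DERIV_fun_powr[unfolded of_nat_1]) (auto intro!: derivative_eq_intros)
    also have "1 / (a * (r - 1)) * ((1 - r) * (1 + exp (- a * (t + u))) powr (1 - r - 1) *
          (exp (- a * (t + u)) * (- a))) =
        exp (- a * (t + u)) * (1 + exp (- a * (t + u))) powr (- r)"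
      using False assms by (simp add: divide_simps) (simp add: algebra_simps)
    finally show ?thesis
      using False by (simp add: F_def[abs_def] gml_generator_def powr_minus divide_simps)
  qed
  have expl: "((\<lambda>u. exp (- a * (t + u))) \<longlongrightarrow> 0) at_top"
    using assms by real_asymp
  have base: "((\<lambda>u. 1 + exp (- a * (t + u))) \<longlongrightarrow> 1 + 0) at_top"
    by (intro tendsto_add tendsto_const expl)
  have lim: "(F \<longlongrightarrow> T) at_top"
  proof (cases "r = 1")
    case True
    then show ?thesis
      using tendsto_mult_left[OF tendsto_ln[OF base], of "- (1 / a)"]
      by (simp add: F_def[abs_def] T_def)
  next
    case False
    then show ?thesis
      using tendsto_mult_left[OF tendsto_powr[OF base tendsto_const[of "1 - r"]], of "1 / (a * (r - 1))"]
      by (simp add: F_def[abs_def] T_def)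
  qed
  \<comment> \<open>Monotonicity gives \<open>F 0 \<le> T\<close>; without it
    \<open>ennreal (T - F 0)\<close> could be a truncated negative number.\<close>
  have "F 0 \<le> F u" if "u \<ge> 0" for u
  proof (rule DERIV_nonneg_imp_nondecreasing[OF that])
    show "\<exists>y. DERIV F x :> y \<and> y \<ge> 0" for x
      using deriv[of x] by (intro exI[of _ "gml_generator a a r (t + x)"]) (simp add: gml_generator_def)
  qed
  then have le: "F 0 \<le> T"
    by (intro tendsto_lowerbound[OF lim]) (auto simp: eventually_at_top_linorder)
  have "ennreal (gml_marginal_generator a a r n (n - 2) t) =
      (\<integral>\<^sup>+u. indicator {0<..} u * ennreal (u powr 0) * ennreal (gml_generator a a r (t + u)) \<partial>lborel)"
    using gml_marginal_generator_nn_integral[of a a r "n - 2" n t, symmetric] assms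
    by (simp add: of_nat_diff del: powr_zero_eq_one)
  also have "\<dots> = (\<integral>\<^sup>+u. ennreal (gml_generator a a r (t + u)) * indicator {0..} u \<partial>lborel)"
  \<comment> \<open>The integrands can differ only at the null point \<open>u = 0\<close>, which the
    open half-line excludes and where \<open>0 powr 0\<close> is 0.\<close>
  proof (rule nn_integral_cong_AE)
    show "AE u in lborel. indicator {0<..} u * ennreal (u powr 0) *
        ennreal (gml_generator a a r (t + u)) = ennreal (gml_generator a a r (t + u)) * indicator {0..} u"
      using AE_lborel_singleton[of "0::real"] by eventually_elim (auto simp: indicator_def)
  qed
  also have "\<dots> = ennreal (T - F 0)"
    by (rule nn_integral_FTC_atLeast[OF _ deriv _ lim])
       (auto simp: gml_generator_def[abs_def])
  finally have "gml_marginal_generator a a r n (n - 2) t = T - F 0"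
    using le gml_marginal_generator_nonneg[of a a r "n - 2" n t] assms by simp
  moreover have "(1 + exp (- a * t)) powr (1 - r) = 1 / (1 + exp (- a * t)) powr (r - 1)"
    using powr_minus_divide[of "1 + exp (- a * t)" "r - 1"] by simp
  ultimately show ?thesis by (simp add: T_def F_def right_diff_distrib)
qed

subsection \<open>Integration along quadratic forms\<close>

lemma emeasure_lborel_scaleR_vimage:
  fixes A :: "'a::euclidean_space set"
  assumes "c > 0" and A: "A \<in> sets borel"
  shows "emeasure lborel A = ennreal (c ^ DIM('a)) * emeasure lborel ((\<lambda>x. c *\<^sub>R x) -` A)"
proof -
  have "emeasure lborel A = emeasure (density (distr lborel borel (\<lambda>x::'a. 0 + c *\<^sub>R x))
      (\<lambda>_. \<bar>c\<bar> ^ DIM('a))) A"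
    by (rule arg_cong[where f = "\<lambda>M. emeasure M A"], rule lborel_affine) (use assms in simp)
  also have "\<dots> = (\<integral>\<^sup>+x. ennreal (\<bar>c\<bar> ^ DIM('a)) * indicator A x \<partial>distr lborel borel (\<lambda>x::'a. 0 + c *\<^sub>R x))"
    using A by (intro emeasure_density) auto
  also have "\<dots> = ennreal (\<bar>c\<bar> ^ DIM('a)) * emeasure (distr lborel borel (\<lambda>x::'a. 0 + c *\<^sub>R x)) A"
    using A by (intro nn_integral_cmult_indicator) auto
  also have "emeasure (distr lborel borel (\<lambda>x::'a. 0 + c *\<^sub>R x)) A = 
     emeasure lborel ((\<lambda>x. 0 + c *\<^sub>R x) -` A \<inter> space lborel)"
    using A by (intro emeasure_distr) auto
  finally show ?thesis using assms(1) by simp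
qed

text \<open>The sublevel sets of \<open>Q\<close> are dilations of each other, so \<open>Q\<close> pushes Lebesgue measure
  forward to a measure giving \<open>{..s}\<close> a mass proportional to \<open>s\<^sup>d\<^sup>/\<^sup>2\<close>.\<close>

lemma nn_integral_quadratic_form:
  fixes Q :: "'a::euclidean_space \<Rightarrow> real"
  assumes cont: "continuous_on UNIV Q"
    and hom: "\<And>c x. Q (c *\<^sub>R x) = c\<^sup>2 * Q x"
    and pos: "\<And>x. x \<noteq> 0 \<Longrightarrow> Q x > 0"
  shows "\<exists>K>0. \<forall>f\<in>borel_measurable borel. (\<integral>\<^sup>+x. f (Q x) \<partial>lborel) =
    ennreal K * (\<integral>\<^sup>+u. indicator {0<..} u * ennreal (u powr (real DIM('a) / 2 - 1)) * f u \<partial>lborel)"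
proof -
  let ?d = "real DIM('a)"
  have [measurable]: "Q \<in> borel_measurable borel"
    using cont by (rule borel_measurable_continuous_onI)
  have Q0: "Q 0 = 0" using hom[of 0 0] by simp
  have nonneg: "Q x \<ge> 0" for x using pos[of x] Q0 by (cases "x = 0") auto
  define V where "V = emeasure lborel {x. Q x \<le> 1}"
  \<comment> \<open>The positive minimum \<open>Q y\<close> on the unit sphere gives
    \<open>Q x \<ge> Q y * (norm x)\<^sup>2\<close> by homogeneity, so the sublevel sets are bounded
    and have finite measure.\<close>
  have "compact (sphere (0::'a) 1)" "sphere (0::'a) 1 \<noteq> {}" by auto
  then obtain y where y: "y \<in> sphere 0 1" "\<And>x. x \<in> sphere 0 1 \<Longrightarrow> Q y \<le> Q x"
    using continuous_attains_inf[of "sphere (0::'a) 1" Q] cont continuous_on_subset by blast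
  have "norm y = 1" using y(1) by simp
  then have "y \<noteq> 0" by auto
  then have "Q y > 0" by (rule pos)
  have lower: "Q y * (norm x)\<^sup>2 \<le> Q x" for x
  proof (cases "x = 0")
    case False
    have "Q x = (norm x)\<^sup>2 * Q (x /\<^sub>R norm x)" 
      using hom[of "norm x" "x /\<^sub>R norm x"] False by simp
    moreover have "Q y \<le> Q (x /\<^sub>R norm x)" using False by (intro y(2)) auto
    ultimately show ?thesis
      using mult_left_mono[of "Q y" "Q (x /\<^sub>R norm x)" "(norm x)\<^sup>2"] by (simp add: mult.commute)
  qed (simp add: Q0)
  have finite_sublevel: "emeasure lborel {x. Q x \<le> s} < \<infinity>" for s
  proof -
    have "{x. Q x \<le> s} \<subseteq> cball 0 (sqrt (s / Q y))"
    proof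
      fix x assume "x \<in> {x. Q x \<le> s}"
      then have "Q y * (norm x)\<^sup>2 \<le> s" using lower[of x] by simp
      then have "(norm x)\<^sup>2 \<le> s / Q y" using \<open>Q y > 0\<close> by (simp add: field_simps)
      then show "x \<in> cball 0 (sqrt (s / Q y))" using real_le_rsqrt by simp
    qed
    then show ?thesis by (intro emeasure_bounded_finite bounded_subset[OF bounded_cball])
  qed
  then have "V < \<infinity>" unfolding V_def .
  moreover have "V > 0"
  proof -
    have "open {x. Q x < 1}" using cont by (intro open_Collect_less) auto
    moreover have "0 \<in> {x. Q x < 1}" by (simp add: Q0)
    ultimately obtain e where e: "e > 0" "ball 0 e \<subseteq> {x. Q x < 1}"
      using openE by blast
    then have "emeasure lborel (ball (0::'a) e) \<le> V"
      unfolding V_def by (intro emeasure_mono) auto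
    moreover have "emeasure lborel (ball (0::'a) e) > 0"
      using content_ball_pos[OF e(1), of "0::'a"]
      by (simp add: measure_def enn2real_positive_iff)
    ultimately show ?thesis by order
  qed
  ultimately obtain v where v: "V = ennreal v" "v > 0"
    by (cases V) auto
  \<comment> \<open>The constant is forced: \<open>v * s powr (d / 2)\<close> has derivative
    \<open>v * (d / 2) * s powr (d / 2 - 1)\<close>.\<close>
  define K where "K = v * (?d / 2)"
  have "K > 0" using v by (simp add: K_def)
  define D where "D u = ennreal K * (indicator {0<..} u * ennreal (u powr (?d / 2 - 1)))" for u
  have [measurable]: "D \<in> borel_measurable borel" unfolding D_def[abs_def] by measurable
  \<comment> \<open>Half-lines form an intersection-stable generator, and those with natural
    endpoints exhaust the line with finite mass, so agreement on half-lines suffices. For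
    \<open>s \<le> 0\<close> both sides vanish.\<close>
  have distr_eq: "distr lborel borel Q = density lborel D"
  proof (rule measure_eqI_generator_eq[where E = "range atMost" and \<Omega> = UNIV and A = "\<lambda>i. {..real i}"])
    show eq: "emeasure (distr lborel borel Q) X = emeasure (density lborel D) X"
      if X_range: "X \<in> range atMost" for X
    proof -
      obtain s where X: "X = {..s}" using X_range by auto
      have L: "emeasure (distr lborel borel Q) X = emeasure lborel {x. Q x \<le> s}"
        by (subst emeasure_distr) (auto simp: X vimage_def)
      have R: "emeasure (density lborel D) X = (\<integral>\<^sup>+u. D u * indicator X u \<partial>lborel)"
        by (subst emeasure_density) (auto simp: X)
      consider "s < 0" | "s = 0" | "s > 0" by linarith
      then show ?thesis
      proof cases
        case 1
        then have "{x. Q x \<le> s} = {}" using nonneg by (auto simp: not_le intro: less_le_trans)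
        moreover have "(\<integral>\<^sup>+u. D u * indicator X u \<partial>lborel) = (\<integral>\<^sup>+u. 0 \<partial>(lborel :: real measure))"
          using 1 by (intro nn_integral_cong) (auto simp: D_def X indicator_def)
        ultimately show ?thesis by (simp add: L R)
      next
        case 2
        then have "{x. Q x \<le> s} = {0}" using pos Q0 by (auto simp: not_le[symmetric])
        moreover have "(\<integral>\<^sup>+u. D u * indicator X u \<partial>lborel) = (\<integral>\<^sup>+u. 0 \<partial>(lborel :: real measure))"
          using 2 by (intro nn_integral_cong) (auto simp: D_def X indicator_def)
        ultimately show ?thesis by (simp add: L R)
      next
        case 3
        have "(\<lambda>x. sqrt s *\<^sub>R x) -` {x. Q x \<le> s} = {x. Q x \<le> 1}"
          using 3 by (auto simp: hom)
        moreover have "{x. Q x \<le> s} \<in> sets borel" by measurable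
        ultimately have "emeasure lborel {x. Q x \<le> s} = ennreal (sqrt s ^ DIM('a)) * V"
          using emeasure_lborel_scaleR_vimage[of "sqrt s" "{x. Q x \<le> s}"] 3 by (simp add: V_def)
        also have "\<dots> = ennreal (s powr (?d / 2)) * V"
        proof -
          have "sqrt s ^ DIM('a) = s powr (?d / 2)"
            using 3 by (simp add: powr_half_sqrt_powr powr_realpow real_sqrt_power)
          then show ?thesis by simp
        qed
        finally have "emeasure lborel {x. Q x \<le> s} = ennreal (s powr (?d / 2)) * V" .
        moreover have "(\<integral>\<^sup>+u. D u * indicator X u \<partial>lborel) = ennreal (s powr (?d / 2)) * V"
        proof -
          have "(\<integral>\<^sup>+u. D u * indicator X u \<partial>lborel) =
              (\<integral>\<^sup>+u. ennreal K * (ennreal (u powr (?d / 2 - 1)) * indicator {0..s} u) \<partial>lborel)"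
            by (intro nn_integral_cong) (auto simp: D_def X indicator_def)
          also have "\<dots> = ennreal K * (\<integral>\<^sup>+u. ennreal (u powr (?d / 2 - 1)) * indicator {0..s} u \<partial>lborel)"
            by (intro nn_integral_cmult) auto
          also have "(\<integral>\<^sup>+u. ennreal (u powr (?d / 2 - 1)) * indicator {0..s} u \<partial>lborel) =
              ennreal (s powr (?d / 2 - 1 + 1) / (?d / 2 - 1 + 1))"
            using 3 DIM_positive[where 'a = 'a]
            by (intro nn_integral_has_integral_lebesgue' has_integral_powr_from_0) auto
          also have "ennreal K * \<dots> = ennreal (s powr (?d / 2)) * V"
            using v \<open>K > 0\<close> by (simp add: K_def mult.commute flip: ennreal_mult')
          finally show ?thesis .
        qed
        ultimately show ?thesis by (simp add: L R)
      qed
    qed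
    show "emeasure (distr lborel borel Q) {..real i} \<noteq> \<infinity>" for i
      using finite_sublevel[of "real i"] by (subst emeasure_distr) (auto simp: vimage_def)
    show "(\<Union>i. {..real i}) = UNIV" using real_arch_simple by auto
    show "Int_stable (range atMost :: real set set)" by (auto simp: Int_stable_def)
  qed (auto simp: borel_eq_atMost)
  have "(\<integral>\<^sup>+x. f (Q x) \<partial>lborel) = ennreal K *
      (\<integral>\<^sup>+u. indicator {0<..} u * ennreal (u powr (?d / 2 - 1)) * f u \<partial>lborel)"
    if [measurable]: "f \<in> borel_measurable borel" for f
  proof -
    have "(\<integral>\<^sup>+x. f (Q x) \<partial>lborel) = (\<integral>\<^sup>+u. f u \<partial>distr lborel borel Q)"
      by (subst nn_integral_distr) auto
    also have "\<dots> = (\<integral>\<^sup>+u. D u * f u \<partial>lborel)"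
      unfolding distr_eq by (subst nn_integral_density) auto
    also have "\<dots> = (\<integral>\<^sup>+u. ennreal K * (indicator {0<..} u * ennreal (u powr (?d / 2 - 1)) * f u) \<partial>lborel)"
      by (simp add: D_def mult.assoc)
    also have "\<dots> = ennreal K *
      (\<integral>\<^sup>+u. indicator {0<..} u * ennreal (u powr (?d / 2 - 1)) * f u \<partial>lborel)"
      by (rule nn_integral_cmult) measurable
    finally show ?thesis .
  qed
  then show ?thesis using \<open>K > 0\<close> by blast
qed

subsection \<open>Block vectors and positive definite matrices\<close>

lemma inner_block_vector: "block_vector x y \<bullet> block_vector x' y' = x \<bullet> x' + y \<bullet> y'"
  by (simp add: inner_vec_def block_vector_def sum.Plus flip: UNIV_Plus_UNIV)

lemma block_matrix_mult:
  "block_matrix A B C D *v block_vector x y = block_vector (A *v x + B *v y) (C *v x + D *v y)"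
proof -
  have "(block_matrix A B C D *v block_vector x y) $ i =
      block_vector (A *v x + B *v y) (C *v x + D *v y) $ i" for i
    by (cases i) (simp_all add: matrix_vector_mult_def block_matrix_def block_vector_def sum.Plus
      flip: UNIV_Plus_UNIV)
  then show ?thesis by (simp add: vec_eq_iff)
qed

lemma linear_block_vector: "linear (\<lambda>(x, y). block_vector x y)"
proof (rule linearI)
  fix p q :: "(real^'a) \<times> (real^'b)" and c :: real
  show "(case p + q of (x, y) \<Rightarrow> block_vector x y) =
      (case p of (x, y) \<Rightarrow> block_vector x y) + (case q of (x, y) \<Rightarrow> block_vector x y)"
    by (auto simp: vec_eq_iff block_vector_def split: sum.split prod.split)
  show "(case c *\<^sub>R p of (x, y) \<Rightarrow> block_vector x y) =
      c *\<^sub>R (case p of (x, y) \<Rightarrow> block_vector x y)"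
    by (auto simp: vec_eq_iff block_vector_def split: sum.split prod.split)
qed

lemma continuous_on_block_vector:
  "continuous_on UNIV (\<lambda>(x :: real^'m::finite, y :: real^'l::finite). block_vector x y)"
  by (intro linear_continuous_on linear_conv_bounded_linear[THEN iffD1] linear_block_vector)

section \<open>Lebesgue measure as a product over the two blocks\<close>

lemma prod_inner_Basis_vec:
  fixes v :: "real^'n"
  shows "(\<Prod>b\<in>Basis. v \<bullet> b) = (\<Prod>i\<in>UNIV. v $ i)"
proof -
  have Basis: "Basis = range (\<lambda>i. axis i 1 :: real^'n)" by (auto simp: Basis_vec_def)
  have "inj (\<lambda>i. axis i 1 :: real^'n)" by (auto intro!: injI simp: axis_eq_axis)
  then show ?thesis unfolding Basis by (subst prod.reindex) (simp_all add: inner_axis)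
qed

text \<open>The preimage of a box is a product of two boxes, and box volumes factor along the
  blocks; boxes determine Lebesgue measure. This is what allows Tonelli's theorem to integrate out
  one block.\<close>

lemma distr_block_vector:
  "distr (lborel \<Otimes>\<^sub>M lborel) borel (\<lambda>(x, y). block_vector x y) =
    (lborel :: (real^('m::finite + 'l::finite)) measure)"
proof (rule lborel_eqI[symmetric])
  fix l u :: "real^('m + 'l)"
  assume le: "\<And>b. b \<in> Basis \<Longrightarrow> l \<bullet> b \<le> u \<bullet> b"
  then have le': "l $ i \<le> u $ i" for i
    using le[of "axis i 1"] by (simp add: inner_axis)
  define l1 l2 u1 u2 where "l1 = (\<chi> i. l $ Inl i)" and "l2 = (\<chi> i. l $ Inr i)"
    and "u1 = (\<chi> i. u $ Inl i)" and "u2 = (\<chi> i. u $ Inr i)"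
  note defs = l1_def l2_def u1_def u2_def
  have le1: "l1 \<bullet> b \<le> u1 \<bullet> b" if "b \<in> Basis" for b
    using le' that by (auto simp: Basis_vec_def inner_axis defs)
  have le2: "l2 \<bullet> b \<le> u2 \<bullet> b" if "b \<in> Basis" for b
    using le' that by (auto simp: Basis_vec_def inner_axis defs)
  have "(\<lambda>(x, y). block_vector x y) -` box l u = box l1 u1 \<times> box l2 u2"
    by (auto simp: interval_cart block_vector_def defs split_sum_all)
  then have "emeasure (distr (lborel \<Otimes>\<^sub>M lborel) borel (\<lambda>(x, y). block_vector x y)) (box l u) =
      emeasure (lborel \<Otimes>\<^sub>M lborel) (box l1 u1 \<times> box l2 u2)"
    using borel_measurable_continuous_onI[OF continuous_on_block_vector[where 'm = 'm and 'l = 'l]]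
    by (subst emeasure_distr) (simp_all add: space_pair_measure borel_prod lborel_prod)
  also have "\<dots> = emeasure lborel (box l1 u1) * emeasure lborel (box l2 u2)"
    by (intro lborel.emeasure_pair_measure_Times) auto
  also have "\<dots> = ennreal ((\<Prod>b\<in>Basis. (u1 - l1) \<bullet> b) * (\<Prod>b\<in>Basis. (u2 - l2) \<bullet> b))"
    using le1 le2
    by (simp add: emeasure_lborel_box ennreal_mult' prod_nonneg inner_diff_left)
  also have "(\<Prod>b\<in>Basis. (u1 - l1) \<bullet> b) * (\<Prod>b\<in>Basis. (u2 - l2) \<bullet> b) = (\<Prod>b\<in>Basis. (u - l) \<bullet> b)"
    unfolding prod_inner_Basis_vec by (simp add: defs prod.Plus flip: UNIV_Plus_UNIV)
  finally show "emeasure (distr (lborel \<Otimes>\<^sub>M lborel) borel (\<lambda>(x, y). block_vector x y)) (box l u) =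
      ennreal (\<Prod>b\<in>Basis. (u - l) \<bullet> b)" .
qed simp

section \<open>Positive definite matrices, their inverses and diagonal blocks\<close>

lemma sym_pos_def_invertible:
  assumes "sym_pos_def S"
  shows "invertible S"
proof -
  have "x = 0" if "S *v x = 0" for x
    using assms that unfolding sym_pos_def_def by (metis inner_zero_right less_irrefl)
  then show ?thesis by (simp add: invertible_left_inverse matrix_left_invertible_ker)
qed

lemma sym_pos_def_inv_mult:
  assumes "sym_pos_def S"
  shows "S *v (matrix_inv S *v x) = x" "matrix_inv S *v (S *v x) = x"
proof -
  have "S ** matrix_inv S = mat 1 \<and> matrix_inv S ** S = mat 1"
    using sym_pos_def_invertible[OF assms] unfolding invertible_def matrix_inv_def by (rule someI_ex)
  then show "S *v (matrix_inv S *v x) = x" "matrix_inv S *v (S *v x) = x"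
    by (simp_all add: matrix_vector_mul_assoc)
qed

lemma sym_pos_def_inner_commute:
  assumes "sym_pos_def S"
  shows "x \<bullet> (S *v y) = (S *v x) \<bullet> y"
  using assms dot_lmul_matrix[of x S y] transpose_matrix_vector[of S x] by (simp add: sym_pos_def_def)

lemma sym_pos_def_inv_inner_commute:
  assumes "sym_pos_def S"
  shows "x \<bullet> (matrix_inv S *v y) = (matrix_inv S *v x) \<bullet> y"
  using sym_pos_def_inner_commute[OF assms, of "matrix_inv S *v x" "matrix_inv S *v y"]
  by (simp add: sym_pos_def_inv_mult[OF assms])

lemma sym_pos_def_inv_pos:
  assumes "sym_pos_def S" "x \<noteq> 0"
  shows "x \<bullet> (matrix_inv S *v x) > 0"
proof -
  have "matrix_inv S *v x \<noteq> 0"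
    using sym_pos_def_inv_mult(1)[OF assms(1), of x] assms(2) by auto
  then have "(matrix_inv S *v x) \<bullet> (S *v (matrix_inv S *v x)) > 0"
    using assms(1) by (simp add: sym_pos_def_def)
  then show ?thesis by (simp add: sym_pos_def_inv_mult[OF assms(1)] inner_commute)
qed

lemma sym_pos_def_inv_nonneg:
  assumes "sym_pos_def S"
  shows "x \<bullet> (matrix_inv S *v x) \<ge> 0"
  using sym_pos_def_inv_pos[OF assms, of x] by (cases "x = 0") auto

text \<open>The form of \<open>S\<close> is the pullback of the form of \<open>\<Sigma>\<close>
  along \<open>\<phi>\<close>, so it inherits symmetry and positivity. Applied to the embedding of a
  block, this makes the corresponding diagonal block positive definite.\<close>

lemma sym_pos_def_compression:
  fixes S :: "real^'k^'k" and \<Sigma> :: "real^'n^'n"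
  assumes \<Sigma>: "sym_pos_def \<Sigma>"
    and \<phi>: "\<And>x. x \<noteq> 0 \<Longrightarrow> \<phi> x \<noteq> 0" "\<And>x y. \<phi> x \<bullet> (\<Sigma> *v \<phi> y) = x \<bullet> (S *v y)"
  shows "sym_pos_def S"
proof -
  have "x \<bullet> (transpose S *v y) = x \<bullet> (S *v y)" for x y
  proof -
    have "x \<bullet> (transpose S *v y) = y \<bullet> (S *v x)"
      using dot_lmul_matrix[of y S x] by (simp add: inner_commute)
    also have "\<dots> = x \<bullet> (S *v y)"
      using sym_pos_def_inner_commute[OF \<Sigma>] by (metis \<phi>(2) inner_commute)
    finally show ?thesis .
  qed
  then have "transpose S *v y = S *v y" for y using vector_eq_ldot by blast
  then have "transpose S = S" by (simp add: matrix_eq)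
  moreover have "x \<bullet> (S *v x) > 0" if "x \<noteq> 0" for x
    using \<Sigma> \<phi>(1)[OF that] unfolding sym_pos_def_def \<phi>(2)[symmetric] by blast
  ultimately show ?thesis by (simp add: sym_pos_def_def)
qed

text \<open>Completing the square; working with \<open>\<Sigma>\<^sup>-\<^sup>1\<close> only through \<open>\<Sigma>\<close> avoids the Schur
  complement, since all that is needed of the second summand is that it is a positive definite
  quadratic form.\<close>

lemma quadratic_form_split:
  fixes \<phi> :: "(real^'k) \<times> (real^'j) \<Rightarrow> real^'n"
  assumes \<Sigma>: "sym_pos_def \<Sigma>" and S: "sym_pos_def S"
    and lin: "linear \<phi>"
    and inner: "\<And>x y x' y'. \<phi> (x, y) \<bullet> \<phi> (x', y') = x \<bullet> x' + y \<bullet> y'"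
    and mult: "\<And>p. \<Sigma> *v \<phi> (p, 0) = \<phi> (S *v p, T *v p)"
  defines "Q \<equiv> \<lambda>v. v \<bullet> (matrix_inv \<Sigma> *v v)"
  shows "Q (\<phi> (x, y)) = x \<bullet> (matrix_inv S *v x) + Q (\<phi> (0, y - T *v (matrix_inv S *v x)))"
proof -
  define p where "p = matrix_inv S *v x"
  \<comment> \<open>The vectors \<open>e\<close> and \<open>f\<close> are orthogonal for the form \<open>Q\<close>.\<close>
  define e where "e = \<phi> (x, T *v p)"
  define f where "f = \<phi> (0, y - T *v p)"
  \<comment> \<open>The second component \<open>T *v p\<close> of \<open>e\<close> is chosen so that
    \<open>matrix_inv \<Sigma> *v e\<close> has no second component, whereas \<open>f\<close> has no
    first one; this gives the orthogonality.\<close>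
  have "\<Sigma> *v \<phi> (p, 0) = e" by (simp add: mult e_def p_def sym_pos_def_inv_mult[OF S])
  then have inv_e: "matrix_inv \<Sigma> *v e = \<phi> (p, 0)"
    using sym_pos_def_inv_mult(2)[OF \<Sigma>] by metis
  have "\<phi> (x, y) = e + f" by (simp add: e_def f_def flip: linear_add[OF lin])
  then have "Q (\<phi> (x, y)) = e \<bullet> (matrix_inv \<Sigma> *v e) + 2 * (f \<bullet> (matrix_inv \<Sigma> *v e)) + Q f"
    using sym_pos_def_inv_inner_commute[OF \<Sigma>, of e f]
    by (simp add: Q_def matrix_vector_right_distrib inner_add_left inner_add_right inner_commute)
  also have "e \<bullet> (matrix_inv \<Sigma> *v e) = x \<bullet> p" unfolding inv_e by (simp add: e_def inner)
  also have "f \<bullet> (matrix_inv \<Sigma> *v e) = 0" unfolding inv_e by (simp add: f_def inner)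
  finally show ?thesis by (simp add: p_def f_def)
qed

subsection \<open>Marginals of elliptical distributions\<close>

text \<open>The isometry \<open>\<phi>\<close> allows either of the two blocks to be the one that is kept.\<close>

lemma Ell_marginal:
  fixes \<phi> :: "(real^'k) \<times> (real^'j) \<Rightarrow> real^'n"
    and X :: "'p \<Rightarrow> real^'n" and Y :: "'p \<Rightarrow> real^'k" and W :: "'p \<Rightarrow> real^'j"
    and S :: "real^'k^'k" and T :: "real^'k^'j" and h G :: "real \<Rightarrow> real"
  assumes Ell: "Ell M X (\<phi> (\<nu>, \<kappa>)) \<Sigma> h"
    and h[measurable]: "h \<in> borel_measurable borel"
    and X: "\<And>\<omega>. X \<omega> = \<phi> (Y \<omega>, W \<omega>)"
    and lin: "linear \<phi>"
    and inner: "\<And>x y x' y'. \<phi> (x, y) \<bullet> \<phi> (x', y') = x \<bullet> x' + y \<bullet> y'"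
    and distr: "distr (lborel \<Otimes>\<^sub>M lborel) borel \<phi> = lborel"
    and mult: "\<And>p. \<Sigma> *v \<phi> (p, 0) = \<phi> (S *v p, T *v p)"
    and G_nonneg: "\<And>t. t \<ge> 0 \<Longrightarrow> G t \<ge> 0"
    and G: "\<And>t. t \<ge> 0 \<Longrightarrow> ennreal (G t) =
      (\<integral>\<^sup>+u. indicator {0<..} u * ennreal (u powr (real CARD('j) / 2 - 1)) * ennreal (h (t + u)) \<partial>lborel)"
  shows "Ell M Y \<nu> S G"
proof -
  have \<Sigma>: "sym_pos_def \<Sigma>" and "prob_space M" and h_nonneg: "\<And>u. u \<ge> 0 \<Longrightarrow> h u \<ge> 0"
    using Ell by (auto simp: Ell_def)
  define Q where "Q v = v \<bullet> (matrix_inv \<Sigma> *v v)" for v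
  obtain C where "C > 0" and dens: "distributed M lborel X
      (\<lambda>z. ennreal (C * det \<Sigma> powr (-1/2) * h (Q (z - \<phi> (\<nu>, \<kappa>)))))"
    using Ell unfolding Ell_def Q_def by blast
  have \<phi>_nonzero: "\<phi> (x, y) \<noteq> 0" if "x \<noteq> 0 \<or> y \<noteq> 0" for x y
  proof
    assume "\<phi> (x, y) = 0"
    then have "x \<bullet> x + y \<bullet> y = 0" using inner[of x y x y] by simp
    then show False using that by (auto simp: add_nonneg_eq_0_iff zero_prod_def)
  qed
  have S: "sym_pos_def S"
    by (rule sym_pos_def_compression[OF \<Sigma>, of "\<lambda>x. \<phi> (x, 0)"]) (auto simp: \<phi>_nonzero mult inner)
  \<comment> \<open>A real \<open>powr\<close> of any nonzero base is positive, so invertibility of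
    \<open>A\<close> is enough here.\<close>
  have det_pos: "det A powr (-1/2) > 0" if "sym_pos_def A" for A :: "real^'i^'i"
    using sym_pos_def_invertible[OF that] by (simp add: invertible_det_nz)
  define D where "D = C * det \<Sigma> powr (-1/2)"
  have "D > 0" using \<open>C > 0\<close> det_pos[OF \<Sigma>] by (simp add: D_def)
  define q where "q x = (x - \<nu>) \<bullet> (matrix_inv S *v (x - \<nu>))" for x
  have q_nonneg: "q x \<ge> 0" for x by (simp add: q_def sym_pos_def_inv_nonneg[OF S])
  have cont_inv: "continuous_on UNIV (\<lambda>v. v \<bullet> (matrix_inv A *v v))" for A :: "real^'i^'i"
    by (intro continuous_intros matrix_vector_mult_linear_continuous_on)
  have [measurable]: "q \<in> borel_measurable borel"
    unfolding q_def[abs_def]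
    by (intro borel_measurable_continuous_onI continuous_intros
      continuous_on_compose2[OF matrix_vector_mult_linear_continuous_on[of UNIV]]) auto
  have [measurable]: "Q \<in> borel_measurable borel"
    unfolding Q_def[abs_def] by (rule borel_measurable_continuous_onI[OF cont_inv])
  have cont_\<phi>: "continuous_on UNIV \<phi>"
    using lin by (intro linear_continuous_on) (simp add: linear_conv_bounded_linear)
  then have [measurable]: "\<phi> \<in> borel_measurable (borel \<Otimes>\<^sub>M borel)"
    by (simp add: borel_prod borel_measurable_continuous_onI)

  \<comment> \<open>\<open>R\<close> is the quadratic form left on the block to be integrated out.
    Its pushforward of Lebesgue measure supplies the weight \<open>u powr (d / 2 - 1)\<close>, with
    \<open>d = CARD('j)\<close>.\<close>
  define R where "R w = Q (\<phi> (0, w))" for w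
  have "\<exists>K>0. \<forall>f\<in>borel_measurable borel. (\<integral>\<^sup>+w. f (R w) \<partial>lborel) = ennreal K *
      (\<integral>\<^sup>+u. indicator {0<..} u * ennreal (u powr (real DIM(real^'j) / 2 - 1)) * f u \<partial>lborel)"
  proof (rule nn_integral_quadratic_form)
    have "continuous_on UNIV (\<lambda>w. \<phi> (0, w))"
      by (intro continuous_on_compose2[OF cont_\<phi>] continuous_intros) auto
    then show "continuous_on UNIV R"
      unfolding R_def[abs_def] Q_def by (intro continuous_on_compose2[OF cont_inv]) auto
    show "R (c *\<^sub>R w) = c\<^sup>2 * R w" for c w
      using linear_scale[OF lin, of c "(0, w)"]
      by (simp add: R_def Q_def matrix_vector_mult_scaleR power2_eq_square)
    show "R w > 0" if "w \<noteq> 0" for w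
      unfolding R_def Q_def by (rule sym_pos_def_inv_pos[OF \<Sigma>]) (simp add: \<phi>_nonzero that)
  qed
  then obtain K where "K > 0" and K: "\<And>f. f \<in> borel_measurable borel \<Longrightarrow> (\<integral>\<^sup>+w. f (R w) \<partial>lborel) = ennreal K *
      (\<integral>\<^sup>+u. indicator {0<..} u * ennreal (u powr (real CARD('j) / 2 - 1)) * f u \<partial>lborel)"
    by auto

  have fibre: "(\<integral>\<^sup>+y. ennreal (D * h (Q (\<phi> (x, y) - \<phi> (\<nu>, \<kappa>)))) \<partial>lborel) =
      ennreal (D * K * G (q x))" for x
  proof -
    \<comment> \<open>\<open>y0\<close> is the centre of the fibre over \<open>x\<close>, the
      conditional location of the second block. Translation by it removes the mixed terms.\<close>
    define y0 where "y0 = \<kappa> + T *v (matrix_inv S *v (x - \<nu>))"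
    have "(\<integral>\<^sup>+y. ennreal (D * h (Q (\<phi> (x, y) - \<phi> (\<nu>, \<kappa>)))) \<partial>lborel) =
        (\<integral>\<^sup>+y. ennreal (D * h (Q (\<phi> (x, y) - \<phi> (\<nu>, \<kappa>)))) \<partial>distr lborel borel ((+) y0))"
      by (simp add: lborel_distr_plus)
    also have "\<dots> = (\<integral>\<^sup>+w. ennreal (D * h (Q (\<phi> (x, y0 + w) - \<phi> (\<nu>, \<kappa>)))) \<partial>lborel)"
      by (rule nn_integral_distr) measurable
    also have "\<dots> = (\<integral>\<^sup>+w. ennreal (D * h (q x + R w)) \<partial>lborel)"
    proof (rule nn_integral_cong)
      fix w
      have "Q (\<phi> (x, y0 + w) - \<phi> (\<nu>, \<kappa>)) = Q (\<phi> (x - \<nu>, y0 + w - \<kappa>))"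
        by (simp flip: linear_diff[OF lin])
      also have "\<dots> = q x + R w"
        unfolding Q_def R_def q_def
        by (subst quadratic_form_split[OF \<Sigma> S lin inner mult]) (simp add: y0_def)
      finally show "ennreal (D * h (Q (\<phi> (x, y0 + w) - \<phi> (\<nu>, \<kappa>)))) = ennreal (D * h (q x + R w))"
        by simp
    qed
    also have "\<dots> = ennreal K * (\<integral>\<^sup>+u. indicator {0<..} u * ennreal (u powr (real CARD('j) / 2 - 1)) *
        ennreal (D * h (q x + u)) \<partial>lborel)"
      by (rule K) measurable
    also have "\<dots> = ennreal K * (\<integral>\<^sup>+u. ennreal D * (indicator {0<..} u *
        ennreal (u powr (real CARD('j) / 2 - 1)) * ennreal (h (q x + u))) \<partial>lborel)"
      using \<open>D > 0\<close> by (simp add: ennreal_mult' mult_ac)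
    also have "\<dots> = ennreal K * (ennreal D * ennreal (G (q x)))"
      by (subst nn_integral_cmult) (simp_all add: G[OF q_nonneg])
    also have "\<dots> = ennreal (D * K * G (q x))"
      using \<open>D > 0\<close> \<open>K > 0\<close> by (simp add: ennreal_mult' mult_ac)
    finally show ?thesis .
  qed

  \<comment> \<open>Since \<open>\<phi>\<close> preserves inner products, pairing with the images of
    the axis vectors recovers the first block. This exhibits \<open>Y\<close> as a measurable
    function of \<open>X\<close>.\<close>
  define \<pi> where "\<pi> z = (\<chi> i. \<phi> (axis i 1, 0) \<bullet> z)" for z
  have \<pi>: "\<pi> (\<phi> (x, y)) = x" for x y by (simp add: \<pi>_def inner inner_axis' vec_eq_iff)
  have "continuous_on UNIV \<pi>" unfolding \<pi>_def[abs_def] by (intro continuous_intros)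
  then have [measurable]: "\<pi> \<in> borel_measurable borel" by (rule borel_measurable_continuous_onI)
  have [measurable]: "X \<in> borel_measurable M" using distributed_measurable[OF dens] by simp
  have Y: "Y = (\<lambda>\<omega>. \<pi> (X \<omega>))" by (simp add: X \<pi>)
  have [measurable]: "Y \<in> borel_measurable M" unfolding Y by measurable

  \<comment> \<open>Measurability is read off from the fibre integral through Tonelli's theorem, as
    \<open>G\<close> is only known through its values.\<close>
  have dens_meas: "(\<lambda>x. ennreal (D * K * G (q x))) \<in> borel_measurable borel"
    unfolding fibre[symmetric] by measurable
  have "distr M lborel Y = density lborel (\<lambda>x. ennreal (D * K * G (q x)))"
  proof (rule measure_eqI)
    fix A assume "A \<in> sets (distr M lborel Y)"
    then have A[measurable]: "A \<in> sets borel" by simp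
    have [measurable]: "\<pi> -` A \<in> sets borel"
      using measurable_sets[of \<pi> borel borel A] by simp
    have "emeasure (distr M lborel Y) A = emeasure (distr M lborel X) (\<pi> -` A)"
      by (subst (1 2) emeasure_distr) (auto simp: Y intro: arg_cong2[where f = emeasure])
    also have "\<dots> = (\<integral>\<^sup>+z. ennreal (D * h (Q (z - \<phi> (\<nu>, \<kappa>)))) * indicator A (\<pi> z) \<partial>lborel)"
      unfolding distributed_distr_eq_density[OF dens] D_def[symmetric]
      by (subst emeasure_density) (auto intro!: nn_integral_cong simp: indicator_def)
    also have "\<dots> = (\<integral>\<^sup>+z. ennreal (D * h (Q (z - \<phi> (\<nu>, \<kappa>)))) * indicator A (\<pi> z)
        \<partial>distr (lborel \<Otimes>\<^sub>M lborel) borel \<phi>)"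
      by (simp only: distr)
    also have "\<dots> = (\<integral>\<^sup>+p. ennreal (D * h (Q (\<phi> p - \<phi> (\<nu>, \<kappa>)))) * indicator A (\<pi> (\<phi> p))
        \<partial>(lborel \<Otimes>\<^sub>M lborel))"
      by (rule nn_integral_distr) measurable
    also have "\<dots> = (\<integral>\<^sup>+x. \<integral>\<^sup>+y. ennreal (D * h (Q (\<phi> (x, y) - \<phi> (\<nu>, \<kappa>)))) *
        indicator A (\<pi> (\<phi> (x, y))) \<partial>lborel \<partial>lborel)"
      by (rule lborel.nn_integral_fst[symmetric]) measurable
    also have "\<dots> = (\<integral>\<^sup>+x. (\<integral>\<^sup>+y. ennreal (D * h (Q (\<phi> (x, y) - \<phi> (\<nu>, \<kappa>)))) \<partial>lborel) *
        indicator A x \<partial>lborel)"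
      unfolding \<pi> by (intro nn_integral_cong nn_integral_multc) measurable
    also have "\<dots> = emeasure (density lborel (\<lambda>x. ennreal (D * K * G (q x)))) A"
      unfolding fibre using dens_meas by (subst emeasure_density) auto
    finally show "emeasure (distr M lborel Y) A =
        emeasure (density lborel (\<lambda>x. ennreal (D * K * G (q x)))) A" .
  qed simp
  then have "distributed M lborel Y (\<lambda>x. ennreal (D * K * G (q x)))"
    using dens_meas by (simp add: distributed_def)
  \<comment> \<open>\<open>C'\<close> compensates for the determinant factor that \<open>Ell\<close>
    expects in the density.\<close>
  moreover define C' where "C' = D * K / det S powr (-1/2)"
  moreover have "C' * det S powr (-1/2) = D * K"
    unfolding C'_def using less_imp_neq[OF det_pos[OF S]] by (metis nonzero_eq_divide_eq)
  ultimately have "distributed M lborel Y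
      (\<lambda>z. ennreal (C' * det S powr (-1/2) * G ((z - \<nu>) \<bullet> (matrix_inv S *v (z - \<nu>)))))"
    by (simp only: q_def)
  moreover have "C' > 0"
    unfolding C'_def using \<open>D > 0\<close> \<open>K > 0\<close> det_pos[OF S] by (intro divide_pos_pos mult_pos_pos)
  ultimately show ?thesis
    unfolding Ell_def using S \<open>prob_space M\<close> G_nonneg by blast
qed

section \<open>Specialization to the logistic generator\<close>

theorem theorem4p1:
  fixes a b r :: real
    and M :: "'p measure"
    and X :: "'p \<Rightarrow> real^('m::finite + 'l::finite)"
    and X1 :: "'p \<Rightarrow> real^'m" and X2 :: "'p \<Rightarrow> real^'l"
    and \<mu> :: "real^('m + 'l)" and \<mu>1 :: "real^'m" and \<mu>2 :: "real^'l"
    and \<Sigma> :: "real^('m + 'l)^('m + 'l)"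
    and \<Sigma>11 :: "real^'m^'m" and \<Sigma>12 :: "real^'l^'m"
    and \<Sigma>21 :: "real^'m^'l" and \<Sigma>22 :: "real^'l^'l"
    and n m :: nat
  assumes "a > 0" and "b > 0" and "r > 0"
    and "n = CARD('m + 'l)" and "m = CARD('m)"
    and "GML M X \<mu> \<Sigma> a b r"
    and "X = (\<lambda>\<omega>. block_vector (X1 \<omega>) (X2 \<omega>))"
    and "\<mu> = block_vector \<mu>1 \<mu>2"
    and "\<Sigma> = block_matrix \<Sigma>11 \<Sigma>12 \<Sigma>21 \<Sigma>22"
  shows "Ell M X1 \<mu>1 \<Sigma>11 (gml_marginal_generator a b r n m) \<and>
    Ell M X2 \<mu>2 \<Sigma>22 (gml_marginal_generator a b r n (n - m)) \<and>
    (m = n - 2 \<and> a = b \<longrightarrow>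
      (\<forall>t\<ge>0. gml_marginal_generator a b r n (n - 2) t =
         (if r \<noteq> 1 then 1 / (a * (r - 1)) * (1 - 1 / (1 + exp (- a * t)) powr (r - 1))
          else 1 / a * ln (1 + exp (- a * t)))))"
proof -
  have n: "n = m + CARD('l)"
    using assms(4,5) by (simp add: card_Plus flip: UNIV_Plus_UNIV)
  have m: "m \<ge> 1" "n - m \<ge> 1" "n - (n - m) = m" "n - m = CARD('l)"
    using n assms(5) zero_less_card_finite[where 'a = 'm] zero_less_card_finite[where 'a = 'l] by auto
  have gen[measurable]: "gml_generator a b r \<in> borel_measurable borel"
    unfolding gml_generator_def[abs_def] by measurable
  have Ell: "Ell M X (block_vector \<mu>1 \<mu>2) \<Sigma> (gml_generator a b r)"
    using assms(6,8) by (simp add: GML_def)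

  have "Ell M X1 \<mu>1 \<Sigma>11 (gml_marginal_generator a b r n m)"
  \<comment> \<open>The first block column of \<open>\<Sigma>\<close> sends \<open>p\<close> to
    \<open>(\<Sigma>11 *v p, \<Sigma>21 *v p)\<close>, which dictates
    \<open>T = \<Sigma>21\<close>.\<close>
  proof (rule Ell_marginal[where \<phi> = "\<lambda>(x, y). block_vector x y" and \<kappa> = \<mu>2 and W = X2 and T = \<Sigma>21])
    show "Ell M X ((\<lambda>(x, y). block_vector x y) (\<mu>1, \<mu>2)) \<Sigma> (gml_generator a b r)"
      using Ell by simp
    show "ennreal (gml_marginal_generator a b r n m t) = (\<integral>\<^sup>+u. indicator {0<..} u *
        ennreal (u powr (real CARD('l) / 2 - 1)) * ennreal (gml_generator a b r (t + u)) \<partial>lborel)"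
      if "t \<ge> 0" for t
      using gml_marginal_generator_nn_integral[of a b r m n t] assms(1-3) that n m by simp
    show "gml_marginal_generator a b r n m t \<ge> 0" if "t \<ge> 0" for t
      using assms(1-3) that n m by (intro gml_marginal_generator_nonneg) auto
  qed (simp_all add: assms(7,9) inner_block_vector linear_block_vector distr_block_vector block_matrix_mult gen)
  moreover have "Ell M X2 \<mu>2 \<Sigma>22 (gml_marginal_generator a b r n (n - m))"
  \<comment> \<open>Here \<open>\<phi>\<close> takes the second block as its first argument, so the
    second block column gives \<open>T = \<Sigma>12\<close>. Its properties reduce to those of
    \<open>block_vector\<close> through the coordinate swap, which preserves product Lebesgue
    measure.\<close>
  proof (rule Ell_marginal[where \<phi> = "\<lambda>(y, x). block_vector x y" and \<kappa> = \<mu>1 and W = X1 and T = \<Sigma>12])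
    have swap: "(\<lambda>(y, x). block_vector x y) = (\<lambda>(x, y). block_vector x y) \<circ> (\<lambda>(y, x). (x :: real^'m, y :: real^'l))"
      by auto
    have "linear (\<lambda>(y, x). (x :: real^'m, y :: real^'l))"
      by (rule linearI) auto
    then show "linear (\<lambda>(y, x). block_vector x y :: real^('m + 'l))"
      unfolding swap using linear_block_vector by (rule linear_compose)
    have "(\<lambda>(x :: real^'m, y :: real^'l). block_vector x y) \<in> borel_measurable (lborel \<Otimes>\<^sub>M lborel)"
      by (simp add: lborel_prod borel_measurable_continuous_onI continuous_on_block_vector)
    then have "distr (lborel \<Otimes>\<^sub>M lborel) borel (\<lambda>(y, x). block_vector x y :: real^('m + 'l)) =
        distr (distr (lborel \<Otimes>\<^sub>M lborel) (lborel \<Otimes>\<^sub>M lborel) (\<lambda>(y, x). (x, y))) borel (\<lambda>(x, y). block_vector x y)"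
      unfolding swap by (intro distr_distr[symmetric] measurable_pair_swap')
    also have "\<dots> = lborel"
      by (simp flip: lborel_pair.distr_pair_swap add: distr_block_vector)
    finally show "distr (lborel \<Otimes>\<^sub>M lborel) borel (\<lambda>(y, x). block_vector x y :: real^('m + 'l)) = lborel" .
    show "Ell M X ((\<lambda>(y, x). block_vector x y) (\<mu>2, \<mu>1)) \<Sigma> (gml_generator a b r)"
      using Ell by simp
    show "ennreal (gml_marginal_generator a b r n (n - m) t) = (\<integral>\<^sup>+u. indicator {0<..} u *
        ennreal (u powr (real CARD('m) / 2 - 1)) * ennreal (gml_generator a b r (t + u)) \<partial>lborel)"
      if "t \<ge> 0" for t
      using gml_marginal_generator_nn_integral[of a b r "n - m" n t] assms(1-3,5) that n m by simp
    show "gml_marginal_generator a b r n (n - m) t \<ge> 0" if "t \<ge> 0" for t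
      using assms(1-3) that n m by (intro gml_marginal_generator_nonneg) auto
  qed (simp_all add: assms(7,9) inner_block_vector block_matrix_mult gen add.commute)
  moreover have "n \<ge> 2" using m by linarith
  ultimately show ?thesis
    using gml_marginal_generator_codim_2[OF assms(1,3)] by blast
qed

end
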